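(* For every set of formulas $\Gamma\cup\{\varphi\}\subseteq \mathbf{F}(\Sigma_{\mathbf{nbI}},\mathcal V)$: if $\Gamma\Vdash^{\mathbf{nbI}}_{\mathcal F}\varphi$ then $\Gamma\vdash_{\mathbf{nbI}}\varphi$.
   Context: Let $\mathcal V$ be a countable set of propositional variables and $\Sigma_{\mathbf{nbI}}=\{\vee,\wedge,\rightarrow,\uparrow,\neg\}$ with $\neg$ unary and the other connectives binary; $\mathbf F(\Sigma_{\mathbf{nbI}},\mathcal V)$ is the set of formulas. The logic $\mathbf{nbI}$ is the Hilbert calculus whose only inference rule is Modus Ponens and whose axioms are all instances (with arbitrary formulas) of: (1) $\alpha\to(\beta\to\alpha)$; (2) $(\alpha\to(\beta\to\gamma))\to((\alpha\to\beta)\to(\alpha\to\gamma))$; (3) $\alpha\to(\beta\to(\alpha\wedge\beta))$; (4) $(\alpha\wedge\beta)\to\alpha$; (5) $(\alpha\wedge\beta)\to\beta$; (6) $\alpha\to(\alpha\vee\beta)$; (7) $\beta\to(\alpha\vee\beta)$; (8) $(\alpha\to\gamma)\to((\beta\to\gamma)\to((\alpha\vee\beta)\to\gamma))$; (9) $(\alpha\to\beta)\vee\alpha$; (Ip) $(\alpha\uparrow\beta)\to(\alpha\to(\beta\to\gamma))$; (Comm) $(\alpha\uparrow\beta)\to(\beta\uparrow\alpha)$; (11) $\alpha\vee\neg\alpha$. $\Gamma\vdash_{\mathbf{nbI}}\varphi$ means that there is a finite derivation of $\varphi$ from premises in $\Gamma$. A $\Sigma$-multialgebra on a nonempty set $A$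 interprets each $n$-ary connective $\sigma$ as a function $\sigma_{\mathcal A}:A^n\to\wp(A)\setminus\{\emptyset\}$; an operation with only singleton values is identified with an ordinary operation. A valuation over $\mathcal A$ is a map $\nu$ from formulas to $A$ with $\nu(\sigma(\varphi_1,\dots,\varphi_n))\in\sigma_{\mathcal A}(\nu(\varphi_1),\dots,\nu(\varphi_n))$ for all connectives $\sigma$ and formulas $\varphi_i$. An RNmatrix (restricted non-deterministic matrix) for $\mathbf{nbI}$ is a triple $(\mathcal A,D,\mathcal F)$ where: - $\mathcal A$ is a $\Sigma_{\mathbf{nbI}}$-multialgebra with universe $A$ in which $\wedge,\vee,\to$ are ordinary operations making $A$ a Boolean algebra with bottom $0$ and top $1$ (with $\to$ the Boolean implication), and such that for all $a,b\in A$, $a\uparrow b=b\uparrow a$ (as sets), for all $a,b,c\in A$, if $c\in a\uparrow b$ then $a\wedge b\wedge c=0$, and for all $a\in A$, $\neg a\subseteq\{b\in A: a\vee b=1\}$; - $D=\{1\}$ (designated elements; $D$ is a proper subset of $A$, i.e. $0\ne1$); - $\mathcal F$ is the set of all valuations $\nu$ over $\mathcal A$ with $\nu(\alpha\uparrow\beta)=\nu(\beta\uparrow\alpha)$ for all formulas $\alpha,\beta$. $\Gamma\Vdash^{\mathbf{nbI}}_{\mathcal F}\varphi$ means: for every RNmatrix $(\mathcal A,D,\mathcal F)$ for $\mathbf{nbI}$ and every $\nu\in\mathcal F$, if $\nu(\gamma)\in D$ for all $\gamma\in\Gamma$ then $\nu(\varphi)\in D$. *)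

theory Defs
  imports Main "HOL-Library.Countable"
begin

section \<open>Formulas and the Hilbert calculus\<close>

datatype 'v fm =
    Var 'v
  | Or "'v fm" "'v fm"  (infixr "\<^bold>\<or>" 65)
  | And "'v fm" "'v fm"  (infixr "\<^bold>\<and>" 66)
  | Imp "'v fm" "'v fm"  (infixr "\<^bold>\<rightarrow>" 64)
  | Inc "'v fm" "'v fm"  (infix "\<^bold>\<up>" 67)
  | Neg "'v fm"  ("\<^bold>\<not> _" [70] 70)

inductive_set nbI_axioms :: "'v fm set" where
  Ax1: "\<alpha> \<^bold>\<rightarrow> (\<beta> \<^bold>\<rightarrow> \<alpha>) \<in> nbI_axioms"
| Ax2: "(\<alpha> \<^bold>\<rightarrow> (\<beta> \<^bold>\<rightarrow> \<gamma>)) \<^bold>\<rightarrow> ((\<alpha> \<^bold>\<rightarrow> \<beta>) \<^bold>\<rightarrow> (\<alpha> \<^bold>\<rightarrow> \<gamma>)) \<in> nbI_axioms"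
| Ax3: "\<alpha> \<^bold>\<rightarrow> (\<beta> \<^bold>\<rightarrow> (\<alpha> \<^bold>\<and> \<beta>)) \<in> nbI_axioms"
| Ax4: "(\<alpha> \<^bold>\<and> \<beta>) \<^bold>\<rightarrow> \<alpha> \<in> nbI_axioms"
| Ax5: "(\<alpha> \<^bold>\<and> \<beta>) \<^bold>\<rightarrow> \<beta> \<in> nbI_axioms"
| Ax6: "\<alpha> \<^bold>\<rightarrow> (\<alpha> \<^bold>\<or> \<beta>) \<in> nbI_axioms"
| Ax7: "\<beta> \<^bold>\<rightarrow> (\<alpha> \<^bold>\<or> \<beta>) \<in> nbI_axioms"
| Ax8: "(\<alpha> \<^bold>\<rightarrow> \<gamma>) \<^bold>\<rightarrow> ((\<beta> \<^bold>\<rightarrow> \<gamma>) \<^bold>\<rightarrow> ((\<alpha> \<^bold>\<or> \<beta>) \<^bold>\<rightarrow> \<gamma>)) \<in> nbI_axioms"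
| Ax9: "(\<alpha> \<^bold>\<rightarrow> \<beta>) \<^bold>\<or> \<alpha> \<in> nbI_axioms"
| Ip: "(\<alpha> \<^bold>\<up> \<beta>) \<^bold>\<rightarrow> (\<alpha> \<^bold>\<rightarrow> (\<beta> \<^bold>\<rightarrow> \<gamma>)) \<in> nbI_axioms"
| Comm: "(\<alpha> \<^bold>\<up> \<beta>) \<^bold>\<rightarrow> (\<beta> \<^bold>\<up> \<alpha>) \<in> nbI_axioms"
| Ax11: "\<alpha> \<^bold>\<or> (\<^bold>\<not> \<alpha>) \<in> nbI_axioms"

definition nbI_derivation :: "'v fm set \<Rightarrow> 'v fm list \<Rightarrow> bool" where
  "nbI_derivation \<Gamma> \<delta> \<longleftrightarrow>
     (\<forall>i < length \<delta>. \<delta> ! i \<in> \<Gamma> \<or> \<delta> ! i \<in> nbI_axioms \<or>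
        (\<exists>j < i. \<exists>k < i. \<delta> ! k = (\<delta> ! j) \<^bold>\<rightarrow> (\<delta> ! i)))"

definition nbI_derives :: "'v fm set \<Rightarrow> 'v fm \<Rightarrow> bool"  (infix "\<turnstile>\<^sub>n\<^sub>b\<^sub>I" 50) where
  "\<Gamma> \<turnstile>\<^sub>n\<^sub>b\<^sub>I \<phi> \<longleftrightarrow> (\<exists>\<delta>. nbI_derivation \<Gamma> \<delta> \<and> \<delta> \<noteq> [] \<and> last \<delta> = \<phi>)"


section \<open>Multialgebras and valuations\<close>

record 'a multialg =
  univ :: "'a set"
  or_op :: "'a \<Rightarrow> 'a \<Rightarrow> 'a set"
  and_op :: "'a \<Rightarrow> 'a \<Rightarrow> 'a set"
  imp_op :: "'a \<Rightarrow> 'a \<Rightarrow> 'a set"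
  inc_op :: "'a \<Rightarrow> 'a \<Rightarrow> 'a set"
  neg_op :: "'a \<Rightarrow> 'a set"

definition multialgebra :: "'a multialg \<Rightarrow> bool" where
  "multialgebra \<A> \<longleftrightarrow>
     univ \<A> \<noteq> {} \<and>
     (\<forall>f \<in> {or_op \<A>, and_op \<A>, imp_op \<A>, inc_op \<A>}.
        \<forall>a \<in> univ \<A>. \<forall>b \<in> univ \<A>. f a b \<in> Pow (univ \<A>) - {{}}) \<and>
     (\<forall>a \<in> univ \<A>. neg_op \<A> a \<in> Pow (univ \<A>) - {{}})"

definition valuation :: "'a multialg \<Rightarrow> ('v fm \<Rightarrow> 'a) \<Rightarrow> bool" where
  "valuation \<A> \<nu> \<longleftrightarrow>
     (\<forall>\<alpha>. \<nu> \<alpha> \<in> univ \<A>) \<and>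
     (\<forall>\<alpha> \<beta>. \<nu> (\<alpha> \<^bold>\<or> \<beta>) \<in> or_op \<A> (\<nu> \<alpha>) (\<nu> \<beta>)) \<and>
     (\<forall>\<alpha> \<beta>. \<nu> (\<alpha> \<^bold>\<and> \<beta>) \<in> and_op \<A> (\<nu> \<alpha>) (\<nu> \<beta>)) \<and>
     (\<forall>\<alpha> \<beta>. \<nu> (\<alpha> \<^bold>\<rightarrow> \<beta>) \<in> imp_op \<A> (\<nu> \<alpha>) (\<nu> \<beta>)) \<and>
     (\<forall>\<alpha> \<beta>. \<nu> (\<alpha> \<^bold>\<up> \<beta>) \<in> inc_op \<A> (\<nu> \<alpha>) (\<nu> \<beta>)) \<and>
     (\<forall>\<alpha>. \<nu> (\<^bold>\<not> \<alpha>) \<in> neg_op \<A> (\<nu> \<alpha>))"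


section \<open>Boolean algebras on a carrier set\<close>

text \<open>The axioms are those of the library locale \<^locale>\<open>abstract_boolean_algebra\<close>, relativised
  to a carrier set: the universes quantified over below are arbitrary nonempty subsets of a type.\<close>

locale boolean_algebra_on =
  fixes A :: "'a set"
    and meet :: "'a \<Rightarrow> 'a \<Rightarrow> 'a" and join :: "'a \<Rightarrow> 'a \<Rightarrow> 'a"
    and compl :: "'a \<Rightarrow> 'a" and zero :: 'a and one :: 'a
  assumes meet_closed: "\<lbrakk>a \<in> A; b \<in> A\<rbrakk> \<Longrightarrow> meet a b \<in> A"
    and join_closed: "\<lbrakk>a \<in> A; b \<in> A\<rbrakk> \<Longrightarrow> join a b \<in> A"
    and compl_closed: "a \<in> A \<Longrightarrow> compl a \<in> A"
    and zero_closed: "zero \<in> A"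
    and one_closed: "one \<in> A"
    and meet_assoc: "\<lbrakk>a \<in> A; b \<in> A; c \<in> A\<rbrakk> \<Longrightarrow> meet (meet a b) c = meet a (meet b c)"
    and join_assoc: "\<lbrakk>a \<in> A; b \<in> A; c \<in> A\<rbrakk> \<Longrightarrow> join (join a b) c = join a (join b c)"
    and meet_commute: "\<lbrakk>a \<in> A; b \<in> A\<rbrakk> \<Longrightarrow> meet a b = meet b a"
    and join_commute: "\<lbrakk>a \<in> A; b \<in> A\<rbrakk> \<Longrightarrow> join a b = join b a"
    and meet_join_distrib:
      "\<lbrakk>a \<in> A; b \<in> A; c \<in> A\<rbrakk> \<Longrightarrow> meet a (join b c) = join (meet a b) (meet a c)"
    and join_meet_distrib:
      "\<lbrakk>a \<in> A; b \<in> A; c \<in> A\<rbrakk> \<Longrightarrow> join a (meet b c) = meet (join a b) (join a c)"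
    and meet_one_right: "a \<in> A \<Longrightarrow> meet a one = a"
    and join_zero_right: "a \<in> A \<Longrightarrow> join a zero = a"
    and meet_compl: "a \<in> A \<Longrightarrow> meet a (compl a) = zero"
    and join_compl: "a \<in> A \<Longrightarrow> join a (compl a) = one"


section \<open>RNmatrices and semantic consequence\<close>

text \<open>An operation whose values are all singletons is identified with an ordinary operation.\<close>

definition ordinary_op :: "'a set \<Rightarrow> ('a \<Rightarrow> 'a \<Rightarrow> 'a set) \<Rightarrow> ('a \<Rightarrow> 'a \<Rightarrow> 'a) \<Rightarrow> bool" where
  "ordinary_op A F f \<longleftrightarrow> (\<forall>a \<in> A. \<forall>b \<in> A. F a b = {f a b})"

definition nbI_multialgebra :: "'a multialg \<Rightarrow> 'a \<Rightarrow> 'a \<Rightarrow> bool" where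
  "nbI_multialgebra \<A> zero one \<longleftrightarrow>
     multialgebra \<A> \<and>
     (\<exists>meet join imp compl.
        ordinary_op (univ \<A>) (and_op \<A>) meet \<and>
        ordinary_op (univ \<A>) (or_op \<A>) join \<and>
        ordinary_op (univ \<A>) (imp_op \<A>) imp \<and>
        boolean_algebra_on (univ \<A>) meet join compl zero one \<and>
        (\<forall>a \<in> univ \<A>. \<forall>b \<in> univ \<A>. imp a b = join (compl a) b) \<and>
        (\<forall>a \<in> univ \<A>. \<forall>b \<in> univ \<A>. inc_op \<A> a b = inc_op \<A> b a) \<and>
        (\<forall>a \<in> univ \<A>. \<forall>b \<in> univ \<A>. \<forall>c \<in> univ \<A>.
           c \<in> inc_op \<A> a b \<longrightarrow> meet (meet a b) c = zero) \<and>
        (\<forall>a \<in> univ \<A>. neg_op \<A> a \<subseteq> {b \<in> univ \<A>. join a b = one}))"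

definition nbI_RNmatrix :: "'a multialg \<Rightarrow> 'a set \<Rightarrow> ('v fm \<Rightarrow> 'a) set \<Rightarrow> bool" where
  "nbI_RNmatrix \<A> D \<F> \<longleftrightarrow>
     (\<exists>zero one. nbI_multialgebra \<A> zero one \<and> zero \<noteq> one \<and> D = {one}) \<and>
     \<F> = {\<nu>. valuation \<A> \<nu> \<and> (\<forall>\<alpha> \<beta>. \<nu> (\<alpha> \<^bold>\<up> \<beta>) = \<nu> (\<beta> \<^bold>\<up> \<alpha>))}"

text \<open>HOL cannot quantify over types inside a formula, so the RNmatrices range over all those whose
  universe is a subset of a given type \<open>'u\<close>, passed as \<open>TYPE('u)\<close>. For infinite \<open>'u\<close> the resulting
  relation does not depend on \<open>'u\<close> when there are countably many variables: a
  counterexample \<open>\<nu>\<close> over any RNmatrix restricts to the countable set \<open>range \<nu>\<close>, with each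
  multioperation intersected with it. This set is closed under the Boolean operations, as
  \<open>\<nu> (\<top> \<^bold>\<up> \<top>)\<close> is the bottom element for \<open>\<top> = (\<alpha> \<^bold>\<rightarrow> \<alpha>)\<close>, and the intersections are
  nonempty, as \<open>\<nu>\<close> is a valuation.\<close>

definition nbI_entails :: "'u itself \<Rightarrow> 'v fm set \<Rightarrow> 'v fm \<Rightarrow> bool" where
  "nbI_entails (_ :: 'u itself) \<Gamma> \<phi> \<longleftrightarrow>
     (\<forall>(\<A> :: 'u multialg) D \<F>. nbI_RNmatrix \<A> D \<F> \<longrightarrow>
        (\<forall>\<nu> \<in> \<F>. (\<forall>\<gamma> \<in> \<Gamma>. \<nu> \<gamma> \<in> D) \<longrightarrow> \<nu> \<phi> \<in> D))"

end

theory Submission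
  imports Defs
begin

text \<open>Suppose that \<open>\<Gamma>\<close> does not derive \<open>\<phi>\<close>. By Zorn's lemma \<open>\<Gamma>\<close> extends to a set \<open>M\<close> that is maximal
  among the sets not deriving \<open>\<phi>\<close> (\<open>saturated_extension\<close>). Such an \<open>M\<close> is deductively closed, and by
  the deduction theorem and \<open>Ax6\<close>, \<open>Ax7\<close>, \<open>Ax8\<close> it is prime: a disjunction is in \<open>M\<close> iff one of its
  disjuncts is. Primeness and \<open>Ax9\<close> make \<open>\<rightarrow>\<close> classical as well, and so membership in \<open>M\<close> is a truth
  assignment that respects \<open>\<or>\<close>, \<open>\<and>\<close> and \<open>\<rightarrow>\<close>; that is, the characteristic function of \<open>M\<close> is a
  homomorphism to the two-element Boolean algebra.

  On that algebra let \<open>\<up>\<close> and \<open>\<not>\<close> be the largest multioperations that an RNmatrix admits. The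
  admissible valuations of the resulting RNmatrix (those in \<open>\<F>\<close>) are the
  classical truth assignments that never make \<open>\<alpha>\<close>, \<open>\<beta>\<close> and
  \<open>\<alpha> \<up> \<beta>\<close> true together, make \<open>\<alpha>\<close> or \<open>\<not>\<alpha>\<close> true, and do not distinguish \<open>\<alpha> \<up> \<beta>\<close> from \<open>\<beta> \<up> \<alpha>\<close>.
  The characteristic function of \<open>M\<close> has these three properties by \<open>Ip\<close>, \<open>Ax11\<close> and \<open>Comm\<close>, and so it
  refutes the consequence of \<open>\<phi>\<close> from \<open>\<Gamma>\<close>. The counterexample lives on any two distinct points of a
  type, hence inside every infinite one.\<close>

section \<open>Derivability and the deduction theorem\<close>

text \<open>Derivability as a closure operator replaces lists of formulas by rule induction.\<close>

inductive derivable :: "'v fm set \<Rightarrow> 'v fm \<Rightarrow> bool" for \<Gamma> where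
  Prem: "\<alpha> \<in> \<Gamma> \<Longrightarrow> derivable \<Gamma> \<alpha>"
| Axiom: "\<alpha> \<in> nbI_axioms \<Longrightarrow> derivable \<Gamma> \<alpha>"
| MP: "derivable \<Gamma> (\<alpha> \<^bold>\<rightarrow> \<beta>) \<Longrightarrow> derivable \<Gamma> \<alpha> \<Longrightarrow> derivable \<Gamma> \<beta>"

lemma nbI_derivation_append:
  assumes "nbI_derivation \<Gamma> xs" "nbI_derivation \<Gamma> ys"
  shows "nbI_derivation \<Gamma> (xs @ ys)"
  unfolding nbI_derivation_def
proof (intro allI impI)
  fix i assume i: "i < length (xs @ ys)"
  let ?zs = "xs @ ys"
  show "?zs ! i \<in> \<Gamma> \<or> ?zs ! i \<in> nbI_axioms \<or>
    (\<exists>j<i. \<exists>k<i. ?zs ! k = (?zs ! j) \<^bold>\<rightarrow> (?zs ! i))"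
  proof (cases "i < length xs")
    case True
    then have nth: "?zs ! j = xs ! j" if "j \<le> i" for j
      using that by (simp add: nth_append)
    have "xs ! i \<in> \<Gamma> \<or> xs ! i \<in> nbI_axioms \<or> (\<exists>j<i. \<exists>k<i. xs ! k = (xs ! j) \<^bold>\<rightarrow> (xs ! i))"
      using assms(1) True unfolding nbI_derivation_def by blast
    then show ?thesis using nth by (metis less_imp_le order_refl)
  next
    case False
    then obtain i' where i': "i = length xs + i'" "i' < length ys"
      using i by (metis add_diff_inverse_nat length_append nat_add_left_cancel_less)
    have nth: "?zs ! (length xs + j) = ys ! j" for j by (simp add: nth_append)
    have "ys ! i' \<in> \<Gamma> \<or> ys ! i' \<in> nbI_axioms \<or>
        (\<exists>j<i'. \<exists>k<i'. ys ! k = (ys ! j) \<^bold>\<rightarrow> (ys ! i'))"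
      using assms(2) i'(2) unfolding nbI_derivation_def by blast
    then show ?thesis unfolding i'(1) using nth by (metis add_strict_left_mono)
  qed
qed

lemma nbI_derivation_snoc:
  assumes "nbI_derivation \<Gamma> xs"
    and "\<beta> \<in> \<Gamma> \<or> \<beta> \<in> nbI_axioms \<or> (\<exists>\<alpha>. \<alpha> \<in> set xs \<and> (\<alpha> \<^bold>\<rightarrow> \<beta>) \<in> set xs)"
  shows "nbI_derivation \<Gamma> (xs @ [\<beta>])"
  unfolding nbI_derivation_def
proof (intro allI impI)
  fix i assume i: "i < length (xs @ [\<beta>])"
  let ?zs = "xs @ [\<beta>]"
  show "?zs ! i \<in> \<Gamma> \<or> ?zs ! i \<in> nbI_axioms \<or>
    (\<exists>j<i. \<exists>k<i. ?zs ! k = (?zs ! j) \<^bold>\<rightarrow> (?zs ! i))"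
  proof (cases "i < length xs")
    case True
    then have nth: "?zs ! j = xs ! j" if "j \<le> i" for j
      using that by (simp add: nth_append)
    have "xs ! i \<in> \<Gamma> \<or> xs ! i \<in> nbI_axioms \<or> (\<exists>j<i. \<exists>k<i. xs ! k = (xs ! j) \<^bold>\<rightarrow> (xs ! i))"
      using assms(1) True unfolding nbI_derivation_def by blast
    then show ?thesis using nth by (metis less_imp_le order_refl)
  next
    case False
    then have i_last: "i = length xs" "?zs ! i = \<beta>" using i by (auto simp: less_Suc_eq)
    from assms(2) consider "\<beta> \<in> \<Gamma> \<or> \<beta> \<in> nbI_axioms"
      | \<alpha> where "\<alpha> \<in> set xs" "(\<alpha> \<^bold>\<rightarrow> \<beta>) \<in> set xs" by blast
    then show ?thesis
    proof cases
      case 1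
      then show ?thesis unfolding i_last(2) by blast
    next
      case (2 \<alpha>)
      then obtain j k where jk: "j < i" "xs ! j = \<alpha>" "k < i" "xs ! k = \<alpha> \<^bold>\<rightarrow> \<beta>"
        unfolding in_set_conv_nth i_last(1) by blast
      then have "?zs ! k = (?zs ! j) \<^bold>\<rightarrow> (?zs ! i)"
        unfolding i_last by (simp add: nth_append)
      then show ?thesis using jk(1,3) by blast
    qed
  qed
qed

lemma derivable_imp_nbI_derives:
  assumes "derivable \<Gamma> \<phi>"
  shows "\<Gamma> \<turnstile>\<^sub>n\<^sub>b\<^sub>I \<phi>"
  using assms
proof induction
  case (Prem \<alpha>)
  then have "nbI_derivation \<Gamma> [\<alpha>]" by (simp add: nbI_derivation_def)
  then show ?case unfolding nbI_derives_def by force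
next
  case (Axiom \<alpha>)
  then have "nbI_derivation \<Gamma> [\<alpha>]" by (simp add: nbI_derivation_def)
  then show ?case unfolding nbI_derives_def by force
next
  case (MP \<alpha> \<beta>)
  then obtain xs ys where
    xs: "nbI_derivation \<Gamma> xs" "xs \<noteq> []" "last xs = \<alpha> \<^bold>\<rightarrow> \<beta>" and
    ys: "nbI_derivation \<Gamma> ys" "ys \<noteq> []" "last ys = \<alpha>"
    unfolding nbI_derives_def by blast
  have "(\<alpha> \<^bold>\<rightarrow> \<beta>) \<in> set (xs @ ys)" "\<alpha> \<in> set (xs @ ys)"
    using last_in_set[OF xs(2)] last_in_set[OF ys(2)] xs(3) ys(3) by simp_all
  then have "nbI_derivation \<Gamma> ((xs @ ys) @ [\<beta>])"
    using nbI_derivation_snoc nbI_derivation_append[OF xs(1) ys(1)] by blast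
  then show ?case unfolding nbI_derives_def by (metis snoc_eq_iff_butlast)
qed

lemma derivable_mono:
  assumes "derivable \<Gamma> \<phi>" "\<Gamma> \<subseteq> \<Delta>"
  shows "derivable \<Delta> \<phi>"
  using assms by induction (auto intro: derivable.intros)

lemma derivable_weaken: "derivable \<Gamma> \<beta> \<Longrightarrow> derivable \<Gamma> (\<alpha> \<^bold>\<rightarrow> \<beta>)"
  by (rule MP[OF Axiom[OF Ax1]])

lemma derivable_refl: "derivable \<Gamma> (\<alpha> \<^bold>\<rightarrow> \<alpha>)"
  by (rule MP[OF MP[OF Axiom[OF Ax2] Axiom[OF Ax1]] Axiom[OF Ax1[of _ \<alpha>]]])

lemma deduction_theorem:
  assumes "derivable (insert \<alpha> \<Gamma>) \<beta>"
  shows "derivable \<Gamma> (\<alpha> \<^bold>\<rightarrow> \<beta>)"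
  using assms
proof induction
  case (Prem \<beta>)
  then show ?case by (auto intro: derivable_refl derivable_weaken derivable.Prem)
next
  case (Axiom \<beta>)
  then show ?case by (intro derivable_weaken derivable.Axiom)
next
  case (MP \<beta> \<gamma>)
  show ?case
    by (rule derivable.MP[OF derivable.MP[OF derivable.Axiom[OF Ax2] MP.IH(1)] MP.IH(2)])
qed

section \<open>Maximal sets that do not derive a given formula\<close>

text \<open>Compactness, in the form that Zorn's lemma uses: an application of Modus Ponens has two
  premises, and of the two members of the chain that derive them the larger one derives both.\<close>

lemma derivable_Union_chain:
  assumes "derivable (\<Union>\<C>) \<phi>" "\<C> \<noteq> {}" "subset.chain \<A> \<C>"
  shows "\<exists>\<Delta>\<in>\<C>. derivable \<Delta> \<phi>"
  using assms(1)
proof induction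
  case (Prem \<alpha>)
  then show ?case using derivable.Prem by blast
next
  case (Axiom \<alpha>)
  then show ?case using assms(2) derivable.Axiom by blast
next
  case (MP \<alpha> \<beta>)
  then obtain \<Delta> \<Theta> where *: "\<Delta> \<in> \<C>" "derivable \<Delta> (\<alpha> \<^bold>\<rightarrow> \<beta>)" "\<Theta> \<in> \<C>" "derivable \<Theta> \<alpha>"
    by blast
  have "\<Delta> \<subseteq> \<Theta> \<or> \<Theta> \<subseteq> \<Delta>" using assms(3) *(1,3) unfolding subset_chain_def by blast
  then show ?case
  proof
    assume "\<Delta> \<subseteq> \<Theta>"
    then show ?case using *(3) derivable.MP[OF derivable_mono[OF *(2)] *(4)] by blast
  next
    assume "\<Theta> \<subseteq> \<Delta>"
    then show ?case using *(1) derivable.MP[OF *(2) derivable_mono[OF *(4)]] by blast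
  qed
qed

locale saturated =
  fixes \<phi> :: "'v fm" and M :: "'v fm set"
  assumes not_derivable: "\<not> derivable M \<phi>"
    and maximal: "\<alpha> \<notin> M \<Longrightarrow> derivable (insert \<alpha> M) \<phi>"

lemma saturated_extension:
  assumes "\<not> derivable \<Gamma> \<phi>"
  obtains M where "\<Gamma> \<subseteq> M" "saturated \<phi> M"
proof -
  let ?\<A> = "{\<Delta>. \<Gamma> \<subseteq> \<Delta> \<and> \<not> derivable \<Delta> \<phi>}"
  have "\<exists>M\<in>?\<A>. \<forall>\<Delta>\<in>?\<A>. M \<subseteq> \<Delta> \<longrightarrow> \<Delta> = M"
  proof (rule subset_Zorn_nonempty)
    show "?\<A> \<noteq> {}" using assms by blast
    fix \<C> assume \<C>: "\<C> \<noteq> {}" "subset.chain ?\<A> \<C>"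
    then have sub: "\<C> \<subseteq> ?\<A>" unfolding subset_chain_def by blast
    have "\<not> derivable (\<Union>\<C>) \<phi>"
      using derivable_Union_chain[OF _ \<C>] sub by blast
    moreover have "\<Gamma> \<subseteq> \<Union>\<C>" using sub \<C>(1) by blast
    ultimately show "\<Union>\<C> \<in> ?\<A>" by blast
  qed
  then obtain M where "M \<in> ?\<A>" and max: "\<forall>\<Delta>\<in>?\<A>. M \<subseteq> \<Delta> \<longrightarrow> \<Delta> = M" by (rule bexE)
  then have M: "\<Gamma> \<subseteq> M" "\<not> derivable M \<phi>" by simp_all
  have "derivable (insert \<alpha> M) \<phi>" if "\<alpha> \<notin> M" for \<alpha>
    using bspec[OF max, of "insert \<alpha> M"] M(1) that by blast
  then have "saturated \<phi> M" using M(2) by (simp add: saturated_def)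
  then show thesis using M(1) that by blast
qed

context saturated
begin

lemma derivable_imp_mem:
  assumes "derivable M \<alpha>"
  shows "\<alpha> \<in> M"
proof (rule ccontr)
  assume "\<alpha> \<notin> M"
  then have "derivable M \<phi>" by (rule MP[OF deduction_theorem[OF maximal] assms])
  then show False using not_derivable by blast
qed

lemma mem_axiom: "\<alpha> \<in> nbI_axioms \<Longrightarrow> \<alpha> \<in> M"
  by (rule derivable_imp_mem[OF Axiom])

lemma mem_MP: "(\<alpha> \<^bold>\<rightarrow> \<beta>) \<in> M \<Longrightarrow> \<alpha> \<in> M \<Longrightarrow> \<beta> \<in> M"
  by (rule derivable_imp_mem[OF MP[OF Prem Prem]])

text \<open>Primeness: if neither \<open>\<alpha>\<close> nor \<open>\<beta>\<close> is in \<open>M\<close>, then \<open>M\<close> derives \<open>\<alpha> \<rightarrow> \<phi>\<close> and \<open>\<beta> \<rightarrow> \<phi>\<close>, and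
  therefore \<open>\<phi>\<close> from \<open>\<alpha> \<or> \<beta>\<close>, by \<open>Ax8\<close>.\<close>

lemma mem_Or_iff: "(\<alpha> \<^bold>\<or> \<beta>) \<in> M \<longleftrightarrow> \<alpha> \<in> M \<or> \<beta> \<in> M"
proof
  assume or: "(\<alpha> \<^bold>\<or> \<beta>) \<in> M"
  show "\<alpha> \<in> M \<or> \<beta> \<in> M"
  proof (rule ccontr)
    assume "\<not> (\<alpha> \<in> M \<or> \<beta> \<in> M)"
    then have "derivable M (\<alpha> \<^bold>\<rightarrow> \<phi>)" "derivable M (\<beta> \<^bold>\<rightarrow> \<phi>)"
      using maximal deduction_theorem by blast+
    then have "derivable M \<phi>" by (rule MP[OF MP[OF MP[OF Axiom[OF Ax8]]] Prem[OF or]])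
    then show False using not_derivable by blast
  qed
qed (auto intro: mem_MP[OF mem_axiom[OF Ax6]] mem_MP[OF mem_axiom[OF Ax7]])

lemma mem_And_iff: "(\<alpha> \<^bold>\<and> \<beta>) \<in> M \<longleftrightarrow> \<alpha> \<in> M \<and> \<beta> \<in> M"
  using mem_MP[OF mem_MP[OF mem_axiom[OF Ax3]]] mem_MP[OF mem_axiom[OF Ax4]]
    mem_MP[OF mem_axiom[OF Ax5]] by blast

text \<open>\<open>Ax9\<close> is what makes the implication classical: with primeness, it puts \<open>\<alpha> \<rightarrow> \<beta>\<close> into \<open>M\<close>
  whenever \<open>\<alpha>\<close> is missing from \<open>M\<close>.\<close>

lemma mem_Imp_iff: "(\<alpha> \<^bold>\<rightarrow> \<beta>) \<in> M \<longleftrightarrow> (\<alpha> \<in> M \<longrightarrow> \<beta> \<in> M)"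
proof -
  have "(\<alpha> \<^bold>\<rightarrow> \<beta>) \<in> M \<or> \<alpha> \<in> M" using mem_axiom[OF Ax9] mem_Or_iff by blast
  moreover have "(\<alpha> \<^bold>\<rightarrow> \<beta>) \<in> M" if "\<beta> \<in> M"
    using that by (rule mem_MP[OF mem_axiom[OF Ax1]])
  ultimately show ?thesis using mem_MP by blast
qed

lemma Inc_consistent: "(\<alpha> \<^bold>\<up> \<beta>) \<in> M \<Longrightarrow> \<alpha> \<in> M \<Longrightarrow> \<beta> \<in> M \<Longrightarrow> False"
  using mem_MP[OF mem_MP[OF mem_MP[OF mem_axiom[OF Ip[of \<alpha> \<beta> \<phi>]]]]] not_derivable Prem by blast

lemma mem_Inc_commute: "(\<alpha> \<^bold>\<up> \<beta>) \<in> M \<longleftrightarrow> (\<beta> \<^bold>\<up> \<alpha>) \<in> M"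
  by (auto intro: mem_MP[OF mem_axiom[OF Comm]])

lemma mem_Neg: "\<alpha> \<in> M \<or> (\<^bold>\<not> \<alpha>) \<in> M"
  using mem_axiom[OF Ax11] mem_Or_iff by blast

end

section \<open>The two-element RNmatrix\<close>

text \<open>The operations for \<open>\<up>\<close> and \<open>\<not>\<close> are the largest ones compatible with the conditions on an
  RNmatrix, so that as many truth assignments as possible are valuations.\<close>

definition two_valued :: "'u \<Rightarrow> 'u \<Rightarrow> 'u multialg" where
  "two_valued z u = \<lparr>
     univ = {z, u},
     or_op = (\<lambda>a b. {if a = u \<or> b = u then u else z}),
     and_op = (\<lambda>a b. {if a = u \<and> b = u then u else z}),
     imp_op = (\<lambda>a b. {if a = u \<longrightarrow> b = u then u else z}),
     inc_op = (\<lambda>a b. {c \<in> {z, u}. \<not> (a = u \<and> b = u \<and> c = u)}),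
     neg_op = (\<lambda>a. {b \<in> {z, u}. a = u \<or> b = u})\<rparr>"

lemma nbI_multialgebra_two_valued:
  assumes "z \<noteq> u"
  shows "nbI_multialgebra (two_valued z u) z u"
proof -
  let ?meet = "\<lambda>a b. if a = u \<and> b = u then u else z"
  let ?join = "\<lambda>a b. if a = u \<or> b = u then u else z"
  let ?imp = "\<lambda>a b. if a = u \<longrightarrow> b = u then u else z"
  let ?compl = "\<lambda>a. if a = u then z else u"
  let ?A = "two_valued z u"
  have "multialgebra ?A" using assms by (auto simp: multialgebra_def two_valued_def)
  moreover have "boolean_algebra_on (univ ?A) ?meet ?join ?compl z u"
    using assms by unfold_locales (auto simp: two_valued_def)
  moreover have "ordinary_op (univ ?A) (and_op ?A) ?meet" "ordinary_op (univ ?A) (or_op ?A) ?join"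
    "ordinary_op (univ ?A) (imp_op ?A) ?imp"
    by (simp_all add: ordinary_op_def two_valued_def)
  moreover have "\<forall>a\<in>univ ?A. \<forall>b\<in>univ ?A. ?imp a b = ?join (?compl a) b"
    "\<forall>a\<in>univ ?A. \<forall>b\<in>univ ?A. inc_op ?A a b = inc_op ?A b a"
    "\<forall>a\<in>univ ?A. \<forall>b\<in>univ ?A. \<forall>c\<in>univ ?A. c \<in> inc_op ?A a b \<longrightarrow> ?meet (?meet a b) c = z"
    "\<forall>a\<in>univ ?A. neg_op ?A a \<subseteq> {b \<in> univ ?A. ?join a b = u}"
    using assms by (auto simp: two_valued_def)
  ultimately show ?thesis unfolding nbI_multialgebra_def by blast
qed

lemma (in saturated) characteristic_valuation:
  assumes "z \<noteq> u"
  shows "valuation (two_valued z u) (\<lambda>\<alpha>. if \<alpha> \<in> M then u else z)"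
  using assms mem_Neg Inc_consistent
  by (auto simp: valuation_def two_valued_def mem_Or_iff mem_And_iff mem_Imp_iff)

theorem theorem8:
  fixes \<Gamma> :: "('v::countable) fm set" and \<phi> :: "'v fm"
  assumes "infinite (UNIV :: 'u set)"
    and "nbI_entails TYPE('u) \<Gamma> \<phi>"
  shows "\<Gamma> \<turnstile>\<^sub>n\<^sub>b\<^sub>I \<phi>"
proof (rule ccontr)
  assume "\<not> \<Gamma> \<turnstile>\<^sub>n\<^sub>b\<^sub>I \<phi>"
  then have "\<not> derivable \<Gamma> \<phi>" using derivable_imp_nbI_derives by blast
  then obtain M where M: "\<Gamma> \<subseteq> M" "saturated \<phi> M" by (rule saturated_extension)
  interpret saturated \<phi> M by (rule M(2))
  obtain z u :: 'u where zu: "z \<noteq> u"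
    using ex_new_if_finite[OF assms(1), of "{undefined}"] by blast
  let ?\<nu> = "\<lambda>\<alpha>. if \<alpha> \<in> M then u else z"
  let ?F = "{\<nu> :: 'v fm \<Rightarrow> 'u. valuation (two_valued z u) \<nu> \<and>
    (\<forall>\<alpha> \<beta>. \<nu> (\<alpha> \<^bold>\<up> \<beta>) = \<nu> (\<beta> \<^bold>\<up> \<alpha>))}"
  have "nbI_RNmatrix (two_valued z u) {u} ?F"
    using nbI_multialgebra_two_valued[OF zu] zu unfolding nbI_RNmatrix_def by blast
  then have entails: "\<nu> \<phi> \<in> {u}" if "\<nu> \<in> ?F" "\<forall>\<gamma>\<in>\<Gamma>. \<nu> \<gamma> \<in> {u}" for \<nu>
    using assms(2) that unfolding nbI_entails_def by blast
  have "?\<nu> \<in> ?F"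
    using characteristic_valuation[OF zu] mem_Inc_commute by simp
  moreover have "\<forall>\<gamma>\<in>\<Gamma>. ?\<nu> \<gamma> \<in> {u}" using M(1) by auto
  ultimately have "?\<nu> \<phi> \<in> {u}" by (rule entails)
  then have "\<phi> \<in> M" using zu by (simp split: if_splits)
  then show False using not_derivable Prem by blast
qed

end
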